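(* Assuming an exact maximum weight matching algorithm Match-Alg, Algorithm 1 returns a matching $M_{OUT}$ whose risk is less or equal than $B$, and whose expected reward is at least $\frac{1}{3}$ of the optimal solution to the Bounded Risk Maximum Weighted Matching problem on uncertain weighted graphs.
   Context: Uncertain weighted (hyper)graph: $n$ nodes, (hyper)edge set $E$ with $|E|=m$; the reward $w(e)$ of each (hyper)edge $e$ is drawn independently from a distribution $f_e$ with finite mean $r_e$ (expected reward) and standard deviation $\sigma_e$. For a matching $M$ (set of pairwise disjoint (hyper)edges), $R(M)=\sum_{e\in M} r_e$ and $risk(M)=\sum_{e\in M}\sigma_e$. The Bounded Risk Maximum Weighted Matching (BR-MWM) problem: given a budget $B$, maximize $R(M)$ over all matchings $M$ with $risk(M)\le B$. Uncertain weighted graphs are the case where every edge has exactly two nodes. Algorithm 1 (takes a black-box algorithm Match-Alg that, given a weighted (hyper)graph, returns a matching): remove all (hyper)edges with $r_e\le 0$ or $\sigma_e>B$; sort the remaining ones as $e_1,\dots,e_m$ so that $\alpha_{e_1}\ge\dots\ge\alpha_{e_m}$ where $\alpha_e=r_e/\sigma_e$; let $H^{(i)}$ contain $e_1,\dots,e_i$ with weights $r_e$, and let $M^{(i)}$ be the output of Match-Alg on $H^{(i)}$. If $risk(M^{(m)})\le B$, output $M^{(m)}$. Otherwise binary search for an index $\ell^*$ with $risk(M^{(\ell^* )})\le B< risk(M^{(\ell^*+1)})$, and output $M_{OUT}$ equal to whichever of $M^{(\ell^* )}$ and $\{e_{\ell^*+1}\}$ has greater expected reward. *)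

theory Defs
  imports "HOL-Probability.Probability"
begin

definition hypergraph :: "'v set \<Rightarrow> 'v set set \<Rightarrow> bool" where
  "hypergraph V E \<longleftrightarrow> finite V \<and> (\<forall>e\<in>E. e \<subseteq> V \<and> e \<noteq> {})"

definition simple_graph :: "'v set \<Rightarrow> 'v set set \<Rightarrow> bool" where
  "simple_graph V E \<longleftrightarrow> hypergraph V E \<and> (\<forall>e\<in>E. card e = 2)"

locale uncertain_weighted_hypergraph = prob_space \<Omega>
  for \<Omega> :: "'w measure" +
  fixes V :: "'v set" and E :: "'v set set"
    and w :: "'v set \<Rightarrow> 'w \<Rightarrow> real"
    and f :: "'v set \<Rightarrow> real measure"
  assumes hypergraph: "hypergraph V E"
    and indep: "indep_vars (\<lambda>_. borel) w E"
    and distribution: "\<And>e. e \<in> E \<Longrightarrow> distr \<Omega> borel (w e) = f e"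
    and finite_mean: "\<And>e. e \<in> E \<Longrightarrow> integrable (f e) (\<lambda>x. x)"
    and finite_second_moment: "\<And>e. e \<in> E \<Longrightarrow> integrable (f e) (\<lambda>x. x\<^sup>2)"

locale uncertain_weighted_graph = uncertain_weighted_hypergraph +
  assumes two_nodes: "\<And>e. e \<in> E \<Longrightarrow> card e = 2"

definition mean :: "real measure \<Rightarrow> real" where
  "mean D = (\<integral>x. x \<partial>D)"

definition std_dev :: "real measure \<Rightarrow> real" where
  "std_dev D = sqrt (\<integral>x. (x - mean D)\<^sup>2 \<partial>D)"

definition matching :: "'v set set \<Rightarrow> 'v set set \<Rightarrow> bool" where
  "matching E M \<longleftrightarrow> M \<subseteq> E \<and> disjoint M"

definition reward :: "('v set \<Rightarrow> real) \<Rightarrow> 'v set set \<Rightarrow> real" where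
  "reward r M = (\<Sum>e\<in>M. r e)"

definition risk :: "('v set \<Rightarrow> real) \<Rightarrow> 'v set set \<Rightarrow> real" where
  "risk \<sigma> M = (\<Sum>e\<in>M. \<sigma> e)"

text \<open>For finite E and nonnegative B the set below is finite and contains the empty matching,
  so the maximum is attained.\<close>

definition br_mwm_opt ::
    "'v set set \<Rightarrow> ('v set \<Rightarrow> real) \<Rightarrow> ('v set \<Rightarrow> real) \<Rightarrow> real \<Rightarrow> real" where
  "br_mwm_opt E r \<sigma> B = (MAX M\<in>{M. matching E M \<and> risk \<sigma> M \<le> B}. reward r M)"

type_synonym 'v match_alg = "'v set \<Rightarrow> 'v set set \<Rightarrow> ('v set \<Rightarrow> real) \<Rightarrow> 'v set set"

definition exact_mwm_alg :: "'v match_alg \<Rightarrow> bool" where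
  "exact_mwm_alg A \<longleftrightarrow>
    (\<forall>V H c. simple_graph V H \<longrightarrow> is_arg_max (reward c) (matching H) (A V H c))"

text \<open>The ratio is taken in the extended reals, so that an edge of positive reward and zero
  standard deviation has ratio \<open>\<infinity>\<close> and is sorted first; real division would give 0.\<close>

definition ratio :: "('v set \<Rightarrow> real) \<Rightarrow> ('v set \<Rightarrow> real) \<Rightarrow> 'v set \<Rightarrow> ereal" where
  "ratio r \<sigma> e = ereal (r e) / ereal (\<sigma> e)"

definition admissible_edges ::
    "'v set set \<Rightarrow> ('v set \<Rightarrow> real) \<Rightarrow> ('v set \<Rightarrow> real) \<Rightarrow> real \<Rightarrow> 'v set set" where
  "admissible_edges E r \<sigma> B = E - {e. r e \<le> 0 \<or> \<sigma> e > B}"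

text \<open>The possible outputs of the algorithm: the order of edges of equal ratio, the index
  found by the binary search and the choice between two candidates of equal reward are left
  open. Lists are indexed from 0, so \<open>es ! l\<close> is the edge number \<open>l + 1\<close> in the sorted order.\<close>

definition algorithm1_returns ::
    "'v match_alg \<Rightarrow> 'v set \<Rightarrow> 'v set set \<Rightarrow> ('v set \<Rightarrow> real) \<Rightarrow> ('v set \<Rightarrow> real) \<Rightarrow> real
      \<Rightarrow> 'v set set \<Rightarrow> bool" where
  "algorithm1_returns A V E r \<sigma> B M_out \<longleftrightarrow>
    (\<exists>es. distinct es \<and> set es = admissible_edges E r \<sigma> B \<and>
      sorted_wrt (\<lambda>e e'. ratio r \<sigma> e \<ge> ratio r \<sigma> e') es \<and>
      (let m = length es; M = (\<lambda>i. A V (set (take i es)) r) in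
        if risk \<sigma> (M m) \<le> B then M_out = M m
        else \<exists>l<m. risk \<sigma> (M l) \<le> B \<and> B < risk \<sigma> (M (l + 1)) \<and>
               is_arg_max (reward r) (\<lambda>N. N \<in> {M l, {es ! l}}) M_out))"

end

theory Submission
  imports Defs
begin

text \<open>Let \<open>e\<close> be the edge whose addition takes the risk of the matching above \<open>B\<close>, let
  \<open>N\<close> and \<open>N'\<close> be the maximum weight matchings before and after \<open>e\<close> is added, and let
  \<open>\<alpha> = r e / \<sigma> e\<close>. Edges up to \<open>e\<close> have ratio at least \<open>\<alpha>\<close>, so
  \<open>R(N') \<ge> \<alpha> \<cdot> risk(N') \<ge> \<alpha> B\<close>; edges from \<open>e\<close> on have ratio at most \<open>\<alpha>\<close>, so their contribution
  to a solution of risk at most \<open>B\<close> is at most \<open>\<alpha> B\<close>. The earlier edges contribute at most \<open>R(N)\<close>.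
  Since \<open>R(N') \<le> R(N) + r e\<close>, the optimum is at most
  \<open>2 R(N) + r e\<close>, that is, at most three times the larger of \<open>R(N)\<close> and \<open>r e\<close>.\<close>

lemma matching_mono: "matching H M \<Longrightarrow> H \<subseteq> E \<Longrightarrow> matching E M"
  by (auto simp: matching_def)

lemma matching_subset: "matching E M \<Longrightarrow> N \<subseteq> M \<Longrightarrow> N \<subseteq> H \<Longrightarrow> matching H N"
  by (auto simp: matching_def pairwise_subset)

lemma finite_matching: "finite E \<Longrightarrow> matching E M \<Longrightarrow> finite M"
  by (auto simp: matching_def intro: finite_subset)

lemma exact_mwm_algD:
  assumes "exact_mwm_alg A" "simple_graph V H"
  shows "matching H (A V H c)"
    and "matching H M \<Longrightarrow> reward c M \<le> reward c (A V H c)"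
  using assms by (auto simp: exact_mwm_alg_def is_arg_max_linorder)

lemma simple_graph_finite: "simple_graph V E \<Longrightarrow> finite E"
  unfolding simple_graph_def hypergraph_def by (rule finite_subset[of _ "Pow V"]) auto

lemma simple_graph_subset: "simple_graph V E \<Longrightarrow> H \<subseteq> E \<Longrightarrow> simple_graph V H"
  by (auto simp: simple_graph_def hypergraph_def)

lemma std_dev_nonneg: "0 \<le> std_dev D"
  by (simp add: std_dev_def)

text \<open>Unlike the comparison of ratios, the cross-multiplied form involves no division by zero.\<close>

lemma ratio_le_cross_mult:
  assumes "ratio r \<sigma> e \<le> ratio r \<sigma> g" "0 < r e" "0 < r g" "0 \<le> \<sigma> e" "0 \<le> \<sigma> g"
  shows "r e * \<sigma> g \<le> r g * \<sigma> e"
proof (cases "\<sigma> g = 0")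
  case True
  then show ?thesis using assms by simp
next
  case g: False
  have "\<sigma> e \<noteq> 0"
    using assms g by (auto simp: ratio_def divide_ereal_def)
  then show ?thesis
    using assms g by (simp add: ratio_def field_simps)
qed

lemma reward_le_crossing:
  assumes fin: "finite H" "finite M"
    and nonneg: "\<And>g. g \<in> insert e H \<union> M \<Longrightarrow> 0 \<le> \<sigma> g"
    and "0 < r e" "0 \<le> B"
    and before: "\<And>g. g \<in> insert e H \<Longrightarrow> r e * \<sigma> g \<le> r g * \<sigma> e"
    and after: "\<And>g. g \<in> M - H \<Longrightarrow> r g * \<sigma> e \<le> r e * \<sigma> g"
    and opt: "\<And>N'. matching H N' \<Longrightarrow> reward r N' \<le> reward r N"
    and N': "matching (insert e H) N'" "B < risk \<sigma> N'"
    and M: "disjoint M" "risk \<sigma> M \<le> B"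
  shows "reward r M \<le> 2 * reward r N + r e"
proof -
  have finN': "finite N'" and N'_sub: "N' \<subseteq> insert e H"
    using fin N'(1) finite_matching[of "insert e H"] by (auto simp: matching_def)
  have N'_dense: "r e * risk \<sigma> N' \<le> reward r N' * \<sigma> e"
    unfolding risk_def reward_def sum_distrib_left sum_distrib_right
    using before N'_sub by (intro sum_mono) auto
  have "\<sigma> e \<noteq> 0"
  proof
    assume "\<sigma> e = 0"
    then have "r e * risk \<sigma> N' \<le> 0" using N'_dense by simp
    then show False using \<open>0 < r e\<close> \<open>0 \<le> B\<close> N'(2) by (simp add: mult_le_0_iff)
  qed
  then have "0 < \<sigma> e" using nonneg[of e] by simp
  have "reward r (M - H) * \<sigma> e \<le> r e * risk \<sigma> (M - H)"
    unfolding risk_def reward_def sum_distrib_left sum_distrib_right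
    using after by (intro sum_mono) auto
  also have "\<dots> \<le> r e * risk \<sigma> N'"
  proof -
    have "risk \<sigma> (M - H) \<le> risk \<sigma> M"
      unfolding risk_def using fin nonneg by (intro sum_mono2) auto
    then show ?thesis using M(2) N'(2) \<open>0 < r e\<close> by simp
  qed
  also note N'_dense
  finally have "reward r (M - H) \<le> reward r N'"
    using \<open>0 < \<sigma> e\<close> by simp
  moreover have "reward r N' \<le> reward r N + r e"
  proof -
    have "reward r N' \<le> reward r (N' - {e}) + r e"
      using finN' \<open>0 < r e\<close> by (cases "e \<in> N'") (simp_all add: reward_def sum.remove)
    moreover have "matching H (N' - {e})"
      using N'(1) N'_sub by (blast intro: matching_subset)
    ultimately show ?thesis using opt[of "N' - {e}"] by simp
  qed
  moreover have "reward r (M \<inter> H) \<le> reward r N"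
    using M(1) by (intro opt) (auto simp: matching_def pairwise_subset)
  moreover have "reward r M = reward r (M \<inter> H) + reward r (M - H)"
    unfolding reward_def using fin(2) by (rule sum.Int_Diff)
  ultimately show ?thesis by simp
qed

lemma br_mwm_opt_le_iff:
  assumes "finite E" "0 \<le> B"
  shows "br_mwm_opt E r \<sigma> B \<le> x \<longleftrightarrow> (\<forall>M. matching E M \<and> risk \<sigma> M \<le> B \<longrightarrow> reward r M \<le> x)"
proof -
  have "finite {M. matching E M \<and> risk \<sigma> M \<le> B}"
    using assms(1) by (auto simp: matching_def intro: finite_subset[of _ "Pow E"])
  moreover have "{} \<in> {M. matching E M \<and> risk \<sigma> M \<le> B}"
    using assms(2) by (simp add: matching_def risk_def)
  ultimately show ?thesis
    unfolding br_mwm_opt_def by (subst Max_le_iff) blast+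
qed

lemma br_mwm_opt_le_admissible:
  assumes "finite E" "0 \<le> B" and nonneg: "\<And>e. e \<in> E \<Longrightarrow> 0 \<le> \<sigma> e"
    and bound: "\<And>M. matching (admissible_edges E r \<sigma> B) M \<Longrightarrow> risk \<sigma> M \<le> B \<Longrightarrow> reward r M \<le> x"
  shows "br_mwm_opt E r \<sigma> B \<le> x"
  unfolding br_mwm_opt_le_iff[OF assms(1,2)]
proof (intro allI impI, elim conjE)
  fix M assume M: "matching E M" "risk \<sigma> M \<le> B"
  have fin: "finite M" and sub: "M \<subseteq> E"
    using M(1) assms(1) finite_matching[of E] by (auto simp: matching_def)
  let ?N = "{e \<in> M. 0 < r e}"
  have "\<sigma> e \<le> B" if "e \<in> M" for e
  proof -
    have "\<sigma> e \<le> risk \<sigma> M"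
      unfolding risk_def using that fin sub nonneg by (intro member_le_sum) auto
    then show ?thesis using M(2) by simp
  qed
  then have "?N \<subseteq> admissible_edges E r \<sigma> B"
    using sub by (force simp: admissible_edges_def)
  with M(1) have "matching (admissible_edges E r \<sigma> B) ?N"
    by (blast intro: matching_subset)
  moreover have "risk \<sigma> ?N \<le> risk \<sigma> M"
    unfolding risk_def using fin sub nonneg by (intro sum_mono2) auto
  moreover have "reward r M \<le> reward r ?N"
  proof -
    have "reward r M = reward r ?N + (\<Sum>e\<in>M - ?N. r e)"
      unfolding reward_def using fin by (subst sum.subset_diff[of ?N M]) auto
    moreover have "(\<Sum>e\<in>M - ?N. r e) \<le> 0" by (intro sum_nonpos) auto
    ultimately show ?thesis by simp
  qed
  ultimately show "reward r M \<le> x" using bound[of ?N] M(2) by simp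
qed

lemma algorithm1_returns_exists:
  assumes graph: "simple_graph V E" and "0 \<le> B" and exact: "exact_mwm_alg A"
  shows "\<exists>M_out. algorithm1_returns A V E r \<sigma> B M_out"
proof -
  let ?F = "admissible_edges E r \<sigma> B"
  have "finite ?F"
    using simple_graph_finite[OF graph] by (simp add: admissible_edges_def)
  then obtain xs where xs: "set xs = ?F" "distinct xs"
    using finite_distinct_list by blast
  define es where "es = sort_key (\<lambda>e. - ratio r \<sigma> e) xs"
  have es: "distinct es" "set es = ?F"
    using xs by (simp_all add: es_def)
  have "sorted (map (\<lambda>e. - ratio r \<sigma> e) es)"
    by (simp add: es_def)
  then have sorted: "sorted_wrt (\<lambda>e e'. ratio r \<sigma> e \<ge> ratio r \<sigma> e') es"
    by (simp add: sorted_wrt_map)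
  define M where "M i = A V (set (take i es)) r" for i
  show ?thesis
  proof (cases "risk \<sigma> (M (length es)) \<le> B")
    case True
    then show ?thesis
      using es sorted unfolding algorithm1_returns_def Let_def M_def by metis
  next
    case False
    have "simple_graph V {}"
      using graph by (rule simple_graph_subset) simp
    then have "M 0 = {}"
      using exact_mwm_algD(1)[OF exact, of V "{}"] by (simp add: M_def matching_def)
    then have "risk \<sigma> (M 0) \<le> B" using \<open>0 \<le> B\<close> by (simp add: risk_def)
    with False obtain l where l: "l < length es" "risk \<sigma> (M l) \<le> B" "\<not> risk \<sigma> (M (Suc l)) \<le> B"
      using ex_least_nat_less[of "\<lambda>i. \<not> risk \<sigma> (M i) \<le> B" "length es"] by auto
    have "is_arg_max (reward r) (\<lambda>N. N \<in> {M l, {es ! l}})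
        (if reward r (M l) \<le> reward r {es ! l} then {es ! l} else M l)"
      by (simp add: is_arg_max_linorder)
    then obtain M_out where "is_arg_max (reward r) (\<lambda>N. N \<in> {M l, {es ! l}}) M_out"
      by blast
    then show ?thesis
      using es sorted l False unfolding algorithm1_returns_def Let_def M_def
      by (intro exI[of _ M_out] exI[of _ es]) (auto simp: not_le)
  qed
qed

lemma algorithm1_returns_correct:
  assumes graph: "simple_graph V E" and "0 \<le> B" and exact: "exact_mwm_alg A"
    and nonneg: "\<And>e. e \<in> E \<Longrightarrow> 0 \<le> \<sigma> e"
    and returns: "algorithm1_returns A V E r \<sigma> B M_out"
  shows "matching E M_out \<and> risk \<sigma> M_out \<le> B \<and> br_mwm_opt E r \<sigma> B \<le> 3 * reward r M_out"
proof -
  let ?F = "admissible_edges E r \<sigma> B"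
  have FE: "?F \<subseteq> E" and F: "\<And>e. e \<in> ?F \<Longrightarrow> 0 < r e \<and> \<sigma> e \<le> B"
    by (auto simp: admissible_edges_def)
  have finE: "finite E" using graph by (rule simple_graph_finite)
  obtain es where es: "set es = ?F"
    and sorted: "sorted_wrt (\<lambda>e e'. ratio r \<sigma> e \<ge> ratio r \<sigma> e') es"
    and out: "let m = length es; M = (\<lambda>i. A V (set (take i es)) r) in
        if risk \<sigma> (M m) \<le> B then M_out = M m
        else \<exists>l<m. risk \<sigma> (M l) \<le> B \<and> B < risk \<sigma> (M (l + 1)) \<and>
               is_arg_max (reward r) (\<lambda>N. N \<in> {M l, {es ! l}}) M_out"
    using returns unfolding algorithm1_returns_def by blast
  define M where "M i = A V (set (take i es)) r" for i
  have take_sub: "set (take i es) \<subseteq> ?F" for i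
    using es set_take_subset[of i es] by simp
  then have graph_take: "simple_graph V (set (take i es))" for i
    using graph FE by (meson simple_graph_subset order_trans)
  note M_matching = exact_mwm_algD(1)[OF exact graph_take, of _ r, folded M_def]
    and M_opt = exact_mwm_algD(2)[OF exact graph_take, of _ _ r, folded M_def]
  have M_matching_E: "matching E (M i)" for i
    using M_matching take_sub FE by (meson matching_mono order_trans)
  show ?thesis
  proof (cases "risk \<sigma> (M (length es)) \<le> B")
    case True
    then have M_out: "M_out = M (length es)"
      using out by (simp add: M_def)
    have "br_mwm_opt E r \<sigma> B \<le> 3 * reward r M_out"
    proof (rule br_mwm_opt_le_admissible[OF finE \<open>0 \<le> B\<close> nonneg])
      fix N assume "matching ?F N"
      then have "reward r N \<le> reward r M_out"
        using M_opt[of "length es" N] es M_out by simp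
      moreover have "0 \<le> reward r M_out"
        using M_opt[of "length es" "{}"] M_out by (simp add: matching_def reward_def)
      ultimately show "reward r N \<le> 3 * reward r M_out" by simp
    qed
    then show ?thesis using True M_out M_matching_E by simp
  next
    case False
    then obtain l where l: "l < length es" "risk \<sigma> (M l) \<le> B" "B < risk \<sigma> (M (Suc l))"
      and argmax: "is_arg_max (reward r) (\<lambda>N. N \<in> {M l, {es ! l}}) M_out"
      using out unfolding Let_def M_def by auto
    define e where "e = es ! l"
    have eF: "e \<in> ?F" using l(1) es by (metis e_def nth_mem)
    have M_out: "M_out = M l \<or> M_out = {e}"
      and best: "reward r (M l) \<le> reward r M_out" "r e \<le> reward r M_out"
      using argmax by (auto simp: is_arg_max_linorder e_def reward_def)
    have "matching E {e}" using eF FE by (auto simp: matching_def)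
    moreover have "risk \<sigma> {e} \<le> B" using F[OF eF] by (simp add: risk_def)
    moreover have "br_mwm_opt E r \<sigma> B \<le> 3 * reward r M_out"
    proof (rule br_mwm_opt_le_admissible[OF finE \<open>0 \<le> B\<close> nonneg])
      fix N assume N: "matching ?F N" "risk \<sigma> N \<le> B"
      have N_sub: "N \<subseteq> ?F" using N(1) by (simp add: matching_def)
      have take_Suc: "set (take (Suc l) es) = insert e (set (take l es))"
        using l(1) by (simp add: take_Suc_conv_app_nth e_def)
      have cross: "r h * \<sigma> g \<le> r g * \<sigma> h"
        if "ratio r \<sigma> h \<le> ratio r \<sigma> g" "h \<in> ?F" "g \<in> ?F" for g h
        using that F FE nonneg by (intro ratio_le_cross_mult) auto
      have "reward r N \<le> 2 * reward r (M l) + r e"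
      proof (rule reward_le_crossing[where H = "set (take l es)" and N' = "M (Suc l)"
            and B = B and \<sigma> = \<sigma>])
        show "finite N" using N_sub FE finE by (meson finite_subset)
        show "0 \<le> \<sigma> g" if "g \<in> insert e (set (take l es)) \<union> N" for g
          using that nonneg FE eF N_sub take_sub[of l] by blast
        show "r e * \<sigma> g \<le> r g * \<sigma> e" if "g \<in> insert e (set (take l es))" for g
        proof (cases "g = e")
          case False
          then have "g \<in> set (take l es)" using that by simp
          then obtain j where "j < l" "g = es ! j"
            by (auto simp: in_set_conv_nth)
          then have "ratio r \<sigma> e \<le> ratio r \<sigma> g"
            using sorted_wrt_nth_less[OF sorted] l(1) by (simp add: e_def)
          then show ?thesis using that eF take_sub[of l] by (blast intro: cross)
        qed simp
        show "r g * \<sigma> e \<le> r e * \<sigma> g" if g: "g \<in> N - set (take l es)" for g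
        proof (cases "g = e")
          case False
          have "g \<in> set es" using g N_sub es by blast
          then obtain j where j: "j < length es" "g = es ! j"
            by (auto simp: in_set_conv_nth)
          have "\<not> j < l"
            using g j by (auto simp: in_set_conv_nth)
          with False j have "l < j" by (auto simp: e_def not_less le_less)
          then have "ratio r \<sigma> g \<le> ratio r \<sigma> e"
            using sorted_wrt_nth_less[OF sorted] j by (simp add: e_def)
          then show ?thesis using g eF N_sub by (blast intro: cross)
        qed simp
        show "matching (insert e (set (take l es))) (M (Suc l))"
          using M_matching[of "Suc l"] take_Suc by simp
        show "disjoint N" using N(1) by (simp add: matching_def)
      qed (use F[OF eF] \<open>0 \<le> B\<close> l N(2) M_opt in auto)
      then show "reward r N \<le> 3 * reward r M_out" using best by simp
    qed
    ultimately show ?thesis using M_out M_matching_E l(2) by auto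
  qed
qed

theorem theorem1:
  fixes \<Omega> :: "'w measure" and V :: "'v set" and E :: "'v set set"
    and w :: "'v set \<Rightarrow> 'w \<Rightarrow> real" and f :: "'v set \<Rightarrow> real measure"
    and B :: real and match_alg :: "'v match_alg"
  defines "r \<equiv> \<lambda>e. mean (f e)" and "\<sigma> \<equiv> \<lambda>e. std_dev (f e)"
  assumes "uncertain_weighted_graph \<Omega> V E w f"
    and "B \<ge> 0"
    and "exact_mwm_alg match_alg"
  shows "(\<exists>M_out. algorithm1_returns match_alg V E r \<sigma> B M_out) \<and>
    (\<forall>M_out. algorithm1_returns match_alg V E r \<sigma> B M_out \<longrightarrow>
      matching E M_out \<and> risk \<sigma> M_out \<le> B \<and>
      reward r M_out \<ge> 1 / 3 * br_mwm_opt E r \<sigma> B)"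
proof -
  interpret uncertain_weighted_graph \<Omega> V E w f by fact
  have graph: "simple_graph V E"
    using hypergraph two_nodes by (simp add: simple_graph_def)
  have nonneg: "0 \<le> \<sigma> e" for e
    by (simp add: \<sigma>_def std_dev_nonneg)
  show ?thesis
    using algorithm1_returns_exists[OF graph assms(4,5), of r \<sigma>]
      algorithm1_returns_correct[where \<sigma> = \<sigma> and r = r, OF graph assms(4,5) nonneg]
    by (auto simp: mult.commute)
qed

end
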